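(* Up to $\mathrm{S4}$-equivalence there are exactly six $\mathrm{S4}$-additive formulas without parameters (i.e. formulas in $\mathrm{Fm}(p)$): $\bot$, $p$, $\Diamond p$, $\top$, $\Diamond\Box\Diamond p$, and $\Diamond\Box\Diamond p\vee p$. Exactly five of them (all except $\top$) are normal in $\mathrm{S4}$.
   Context: $\mathrm{Fm}(p)$ is the set of modal formulas (built with Boolean connectives, $\bot,\top,\Diamond,\Box$) containing no variables other than $p$. For a normal modal logic $\Lambda$, formulas $\varphi,\psi$ are $\Lambda$-equivalent if $\Lambda\vdash\varphi\leftrightarrow\psi$. A formula $\varphi(p)$ is $\Lambda$-additive if $\Lambda\vdash\varphi(p\vee q)\leftrightarrow\varphi(p)\vee\varphi(q)$ (with $q$ a variable distinct from $p$), and normal in $\Lambda$ if $\Lambda\vdash\varphi(\bot)\leftrightarrow\bot$. $\mathrm{S4}$ is the usual normal modal logic of reflexive transitive frames. *)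

theory Defs imports Main begin

datatype fm =
    Var nat
  | Bot ("\<bottom>\<^sub>m")
  | Top ("\<top>\<^sub>m")
  | Neg fm ("\<not>\<^sub>m _" [70] 70)
  | And fm fm (infixr "\<and>\<^sub>m" 65)
  | Or fm fm (infixr "\<or>\<^sub>m" 60)
  | Imp fm fm (infixr "\<rightarrow>\<^sub>m" 55)
  | Dia fm ("\<diamond> _" [70] 70)
  | Box fm ("\<box> _" [70] 70)

abbreviation Iff :: "fm \<Rightarrow> fm \<Rightarrow> fm" (infix "\<leftrightarrow>\<^sub>m" 50) where
  "\<phi> \<leftrightarrow>\<^sub>m \<psi> \<equiv> (\<phi> \<rightarrow>\<^sub>m \<psi>) \<and>\<^sub>m (\<psi> \<rightarrow>\<^sub>m \<phi>)"

primrec vars :: "fm \<Rightarrow> nat set" where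
  "vars (Var x) = {x}"
| "vars \<bottom>\<^sub>m = {}"
| "vars \<top>\<^sub>m = {}"
| "vars (\<not>\<^sub>m \<phi>) = vars \<phi>"
| "vars (\<phi> \<and>\<^sub>m \<psi>) = vars \<phi> \<union> vars \<psi>"
| "vars (\<phi> \<or>\<^sub>m \<psi>) = vars \<phi> \<union> vars \<psi>"
| "vars (\<phi> \<rightarrow>\<^sub>m \<psi>) = vars \<phi> \<union> vars \<psi>"
| "vars (\<diamond> \<phi>) = vars \<phi>"
| "vars (\<box> \<phi>) = vars \<phi>"

definition Fm :: "nat \<Rightarrow> fm set" where
  "Fm p = {\<phi>. vars \<phi> \<subseteq> {p}}"

primrec subst :: "(nat \<Rightarrow> fm) \<Rightarrow> fm \<Rightarrow> fm" where
  "subst \<sigma> (Var x) = \<sigma> x"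
| "subst \<sigma> \<bottom>\<^sub>m = \<bottom>\<^sub>m"
| "subst \<sigma> \<top>\<^sub>m = \<top>\<^sub>m"
| "subst \<sigma> (\<not>\<^sub>m \<phi>) = \<not>\<^sub>m subst \<sigma> \<phi>"
| "subst \<sigma> (\<phi> \<and>\<^sub>m \<psi>) = subst \<sigma> \<phi> \<and>\<^sub>m subst \<sigma> \<psi>"
| "subst \<sigma> (\<phi> \<or>\<^sub>m \<psi>) = subst \<sigma> \<phi> \<or>\<^sub>m subst \<sigma> \<psi>"
| "subst \<sigma> (\<phi> \<rightarrow>\<^sub>m \<psi>) = subst \<sigma> \<phi> \<rightarrow>\<^sub>m subst \<sigma> \<psi>"
| "subst \<sigma> (\<diamond> \<phi>) = \<diamond> subst \<sigma> \<phi>"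
| "subst \<sigma> (\<box> \<phi>) = \<box> subst \<sigma> \<phi>"

definition inst :: "nat \<Rightarrow> fm \<Rightarrow> fm \<Rightarrow> fm" where
  "inst p \<phi> \<chi> = subst (Var(p := \<chi>)) \<phi>"

text \<open>Propositional evaluation: variables and formulas with an outermost modality are
  treated as atoms, with truth values given by \<open>v\<close>.\<close>

primrec peval :: "(fm \<Rightarrow> bool) \<Rightarrow> fm \<Rightarrow> bool" where
  "peval v (Var x) = v (Var x)"
| "peval v \<bottom>\<^sub>m = False"
| "peval v \<top>\<^sub>m = True"
| "peval v (\<not>\<^sub>m \<phi>) = (\<not> peval v \<phi>)"
| "peval v (\<phi> \<and>\<^sub>m \<psi>) = (peval v \<phi> \<and> peval v \<psi>)"
| "peval v (\<phi> \<or>\<^sub>m \<psi>) = (peval v \<phi> \<or> peval v \<psi>)"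
| "peval v (\<phi> \<rightarrow>\<^sub>m \<psi>) = (peval v \<phi> \<longrightarrow> peval v \<psi>)"
| "peval v (\<diamond> \<phi>) = v (\<diamond> \<phi>)"
| "peval v (\<box> \<phi>) = v (\<box> \<phi>)"

definition tautology :: "fm \<Rightarrow> bool" where
  "tautology \<phi> \<longleftrightarrow> (\<forall>v. peval v \<phi>)"

text \<open>The least normal modal logic containing the axioms \<open>Ax\<close>. Both modalities are
  primitive, so their duality is an axiom. Derivability in a logic is membership.\<close>

inductive_set normal_logic :: "fm set \<Rightarrow> fm set" for Ax :: "fm set" where
  axiom: "\<phi> \<in> Ax \<Longrightarrow> \<phi> \<in> normal_logic Ax"
| taut: "tautology \<phi> \<Longrightarrow> \<phi> \<in> normal_logic Ax"
| K: "\<box> (Var 0 \<rightarrow>\<^sub>m Var 1) \<rightarrow>\<^sub>m (\<box> Var 0 \<rightarrow>\<^sub>m \<box> Var 1) \<in> normal_logic Ax"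
| dual: "(\<diamond> Var 0 \<leftrightarrow>\<^sub>m \<not>\<^sub>m \<box> \<not>\<^sub>m Var 0) \<in> normal_logic Ax"
| mp: "\<phi> \<rightarrow>\<^sub>m \<psi> \<in> normal_logic Ax \<Longrightarrow> \<phi> \<in> normal_logic Ax \<Longrightarrow> \<psi> \<in> normal_logic Ax"
| nec: "\<phi> \<in> normal_logic Ax \<Longrightarrow> \<box> \<phi> \<in> normal_logic Ax"
| us: "\<phi> \<in> normal_logic Ax \<Longrightarrow> subst \<sigma> \<phi> \<in> normal_logic Ax"

definition S4 :: "fm set" where
  "S4 = normal_logic {\<box> Var 0 \<rightarrow>\<^sub>m Var 0, \<box> Var 0 \<rightarrow>\<^sub>m \<box> \<box> Var 0}"

definition equivalent :: "fm set \<Rightarrow> fm \<Rightarrow> fm \<Rightarrow> bool" where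
  "equivalent \<Lambda> \<phi> \<psi> \<longleftrightarrow> (\<phi> \<leftrightarrow>\<^sub>m \<psi>) \<in> \<Lambda>"

text \<open>Additivity and normality of \<open>\<phi>\<close> as a formula \<open>\<phi>(p)\<close>. In the former, \<open>q\<close> is meant to be
  a variable distinct from \<open>p\<close> that does not occur in \<open>\<phi>\<close>.\<close>

definition additive_in :: "fm set \<Rightarrow> nat \<Rightarrow> nat \<Rightarrow> fm \<Rightarrow> bool" where
  "additive_in \<Lambda> p q \<phi> \<longleftrightarrow>
     (inst p \<phi> (Var p \<or>\<^sub>m Var q) \<leftrightarrow>\<^sub>m inst p \<phi> (Var p) \<or>\<^sub>m inst p \<phi> (Var q)) \<in> \<Lambda>"

definition normal_in :: "fm set \<Rightarrow> nat \<Rightarrow> fm \<Rightarrow> bool" where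
  "normal_in \<Lambda> p \<phi> \<longleftrightarrow> (inst p \<phi> \<bottom>\<^sub>m \<leftrightarrow>\<^sub>m \<bottom>\<^sub>m) \<in> \<Lambda>"

definition six_formulas :: "nat \<Rightarrow> fm set" where
  "six_formulas p =
     {\<bottom>\<^sub>m, Var p, \<diamond> Var p, \<top>\<^sub>m, \<diamond> \<box> \<diamond> Var p, \<diamond> \<box> \<diamond> Var p \<or>\<^sub>m Var p}"

end

theory Submission imports Defs begin

text \<open>By the finite model property, an additive \<open>\<phi>(p)\<close> with \<open>\<phi>(\<bottom>) = \<bottom>\<close> is determined by the
  relation \<open>x \<in> \<phi>({a})\<close> on finite preorders. This relation is contained in the preorder and is
  compatible with p-morphisms. Doubling every point of a frame makes all clusters nontrivial, and the
  doubled frame then has p-morphisms, isolating a given copy of \<open>a\<close>, onto very small frames. Hence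
  whether \<open>x \<in> \<phi>({a})\<close> only depends on whether \<open>a\<close> lies in a maximal cluster and whether
  \<open>x = a\<close>; this leaves the six possibilities.\<close>

section \<open>Kripke semantics\<close>

text \<open>Additivity splits finite unions only, so completeness is wanted for frames in which each
  point sees finitely many points. The obstacle is that isolating \<open>a\<close> needs other
  points for \<open>a\<close> to see: if \<open>a\<close> sees only itself, no p-morphism onto a
  two-element cluster has \<open>{a}\<close> as a fibre. Doubling supplies a twin of
  \<open>a\<close> to lie over the other point. The price is that \<open>a\<close> has two copies,
  so its value becomes a disjunction over them. The two kinds of \<open>a\<close> give four bits:
  \<open>s\<close>, \<open>r\<close> for maximal clusters and \<open>d\<close>, \<open>e\<close> for
  the others, the first of each pair for a point other than \<open>a\<close>, the second for
  \<open>a\<close> itself. They are linked by \<open>d \<longrightarrow> s\<close> and by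
  \<open>e \<or> d \<or> s \<longleftrightarrow> r \<or> s\<close>. If \<open>s\<close> fails, then
  so does \<open>d\<close>, and \<open>e\<close> equals \<open>r\<close>: this gives
  \<open>\<bottom>\<^sub>m\<close> and \<open>Var p\<close>. If \<open>s\<close> holds, the pair of
  \<open>d\<close> and \<open>d \<or> e\<close> has three possible values: the two formulas with
  \<open>\<diamond> \<box> \<diamond> Var p\<close>, and \<open>\<diamond> Var p\<close>. Finally
  \<open>\<top>\<^sub>m\<close> is the only case that is not normal, because the value at the empty
  set is constant.\<close>

primrec ext :: "('w \<Rightarrow> 'w \<Rightarrow> bool) \<Rightarrow> (nat \<Rightarrow> 'w set) \<Rightarrow> fm \<Rightarrow> 'w set" where
  "ext R V (Var n) = V n"
| "ext R V \<bottom>\<^sub>m = {}"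
| "ext R V \<top>\<^sub>m = UNIV"
| "ext R V (\<not>\<^sub>m \<phi>) = - ext R V \<phi>"
| "ext R V (\<phi> \<and>\<^sub>m \<psi>) = ext R V \<phi> \<inter> ext R V \<psi>"
| "ext R V (\<phi> \<or>\<^sub>m \<psi>) = ext R V \<phi> \<union> ext R V \<psi>"
| "ext R V (\<phi> \<rightarrow>\<^sub>m \<psi>) = - ext R V \<phi> \<union> ext R V \<psi>"
| "ext R V (\<diamond> \<phi>) = {x. \<exists>y. R x y \<and> y \<in> ext R V \<phi>}"
| "ext R V (\<box> \<phi>) = {x. \<forall>y. R x y \<longrightarrow> y \<in> ext R V \<phi>}"

lemma ext_iff_peval: "x \<in> ext R V \<phi> \<longleftrightarrow> peval (\<lambda>\<psi>. x \<in> ext R V \<psi>) \<phi>"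
  by (induction \<phi>) auto

lemma ext_subst: "ext R V (subst \<sigma> \<phi>) = ext R (\<lambda>n. ext R V (\<sigma> n)) \<phi>"
  by (induction \<phi>) auto

lemma ext_cong_vars: "(\<And>n. n \<in> vars \<phi> \<Longrightarrow> V n = V' n) \<Longrightarrow> ext R V \<phi> = ext R V' \<phi>"
  by (induction \<phi>) auto

text \<open>Truth at a point depends only on the points reachable from it. Comparing two valuations
  on one frame avoids introducing generated subframes as types of their own.\<close>

lemma ext_cong_upset:
  assumes up: "\<And>y z. y \<in> U \<Longrightarrow> R y z \<Longrightarrow> z \<in> U"
    and V: "\<And>n y. y \<in> U \<Longrightarrow> y \<in> V n \<longleftrightarrow> y \<in> V' n"
  shows "x \<in> U \<Longrightarrow> x \<in> ext R V \<phi> \<longleftrightarrow> x \<in> ext R V' \<phi>"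
proof (induction \<phi> arbitrary: x)
  case (Var n)
  then show ?case using V by (simp only: ext.simps)
next
  case (Dia \<phi>)
  then show ?case using up[OF Dia.prems] unfolding ext.simps by blast
next
  case (Box \<phi>)
  then show ?case using up[OF Box.prems] unfolding ext.simps by blast
qed (simp_all only: ext.simps Un_iff Int_iff Compl_iff UNIV_I empty_iff)

theorem S4_sound:
  assumes "\<phi> \<in> S4" "reflp R" "transp R"
  shows "ext R V \<phi> = UNIV"
  using assms(1) unfolding S4_def
proof (induction arbitrary: V rule: normal_logic.induct)
  case (axiom \<phi>)
  have "R x x" and "R x y \<Longrightarrow> R y z \<Longrightarrow> R x z" for x y z
    using assms(2,3) by (blast dest: reflpD transpD)+
  then have "ext R V (\<box> Var 0 \<rightarrow>\<^sub>m Var 0) = UNIV"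
    "ext R V (\<box> Var 0 \<rightarrow>\<^sub>m \<box> \<box> Var 0) = UNIV"
    unfolding ext.simps by blast+
  then show ?case using axiom by (elim insertE emptyE) (simp_all only:)
next
  case (taut \<phi>)
  then have "x \<in> ext R V \<phi>" for x
    by (subst ext_iff_peval) (simp only: tautology_def)
  then show ?case by blast
next
  case (mp \<phi> \<psi>)
  then show ?case by (simp only: ext.simps) blast
next
  case (us \<phi> \<sigma>)
  then show ?case by (simp only: ext_subst)
qed (unfold ext.simps, blast+)

text \<open>Covers quotient maps as well as inclusions of generated subframes; both kinds occur
  below.\<close>

definition p_morphism :: "('v \<Rightarrow> 'w) \<Rightarrow> ('v \<Rightarrow> 'v \<Rightarrow> bool) \<Rightarrow> ('w \<Rightarrow> 'w \<Rightarrow> bool) \<Rightarrow> bool" where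
  "p_morphism f R S \<longleftrightarrow>
     (\<forall>x y. R x y \<longrightarrow> S (f x) (f y)) \<and> (\<forall>x z. S (f x) z \<longrightarrow> (\<exists>y. R x y \<and> f y = z))"

lemma ext_p_morphism:
  assumes "p_morphism f R S"
  shows "ext R (\<lambda>n. f -` V n) \<phi> = f -` ext S V \<phi>"
proof (induction \<phi>)
  case (Dia \<phi>)
  have "(\<exists>y. R x y \<and> f y \<in> A) \<longleftrightarrow> (\<exists>z. S (f x) z \<and> z \<in> A)" for x A
    using assms unfolding p_morphism_def by blast
  then show ?case using Dia by auto
next
  case (Box \<phi>)
  have "(\<forall>y. R x y \<longrightarrow> f y \<in> A) \<longleftrightarrow> (\<forall>z. S (f x) z \<longrightarrow> z \<in> A)" for x A
    using assms unfolding p_morphism_def by blast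
  then show ?case using Box by auto
qed auto

section \<open>Completeness with respect to finite preorders\<close>

lemma S4_taut: "tautology \<phi> \<Longrightarrow> \<phi> \<in> S4"
  unfolding S4_def by (rule normal_logic.taut)

lemma S4_nec: "\<phi> \<in> S4 \<Longrightarrow> \<box> \<phi> \<in> S4"
  unfolding S4_def by (rule normal_logic.nec)

lemma S4_subst: "\<phi> \<in> S4 \<Longrightarrow> subst \<sigma> \<phi> \<in> S4"
  unfolding S4_def by (rule normal_logic.us)

lemma S4_K: "\<box> (\<phi> \<rightarrow>\<^sub>m \<psi>) \<rightarrow>\<^sub>m (\<box> \<phi> \<rightarrow>\<^sub>m \<box> \<psi>) \<in> S4"
proof -
  have "\<box> (Var 0 \<rightarrow>\<^sub>m Var 1) \<rightarrow>\<^sub>m (\<box> Var 0 \<rightarrow>\<^sub>m \<box> Var 1) \<in> S4"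
    unfolding S4_def by (rule normal_logic.K)
  from S4_subst[OF this, of "\<lambda>n. if n = 0 then \<phi> else \<psi>"] show ?thesis by simp
qed

lemma S4_dual: "(\<diamond> \<phi> \<leftrightarrow>\<^sub>m \<not>\<^sub>m \<box> \<not>\<^sub>m \<phi>) \<in> S4"
proof -
  have "(\<diamond> Var 0 \<leftrightarrow>\<^sub>m \<not>\<^sub>m \<box> \<not>\<^sub>m Var 0) \<in> S4"
    unfolding S4_def by (rule normal_logic.dual)
  from S4_subst[OF this, of "\<lambda>n. \<phi>"] show ?thesis by simp
qed

lemma S4_T: "\<box> \<phi> \<rightarrow>\<^sub>m \<phi> \<in> S4"
proof -
  have "\<box> Var 0 \<rightarrow>\<^sub>m Var 0 \<in> S4"
    unfolding S4_def by (rule normal_logic.axiom) simp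
  from S4_subst[OF this, of "\<lambda>n. \<phi>"] show ?thesis by simp
qed

lemma S4_4: "\<box> \<phi> \<rightarrow>\<^sub>m \<box> \<box> \<phi> \<in> S4"
proof -
  have "\<box> Var 0 \<rightarrow>\<^sub>m \<box> \<box> Var 0 \<in> S4"
    unfolding S4_def by (rule normal_logic.axiom) simp
  from S4_subst[OF this, of "\<lambda>n. \<phi>"] show ?thesis by simp
qed

text \<open>Closure is under modus ponens alone: necessitation and substitution preserve validity,
  but not truth at a point, and these sets are to become the formulas true at a point.\<close>

definition S4_theory :: "fm set \<Rightarrow> bool" where
  "S4_theory T \<longleftrightarrow> S4 \<subseteq> T \<and> (\<forall>\<phi> \<psi>. \<phi> \<rightarrow>\<^sub>m \<psi> \<in> T \<longrightarrow> \<phi> \<in> T \<longrightarrow> \<psi> \<in> T)"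

lemma S4_theoryD:
  assumes "S4_theory T"
  shows S4_theory_thm: "\<phi> \<in> S4 \<Longrightarrow> \<phi> \<in> T"
    and S4_theory_mp: "\<phi> \<rightarrow>\<^sub>m \<psi> \<in> T \<Longrightarrow> \<phi> \<in> T \<Longrightarrow> \<psi> \<in> T"
  using assms unfolding S4_theory_def by auto

lemma S4_theory_taut: "S4_theory T \<Longrightarrow> tautology \<phi> \<Longrightarrow> \<phi> \<in> T"
  by (simp add: S4_taut S4_theory_thm)

lemma S4_theory_S4: "S4_theory S4"
proof -
  have "\<phi> \<rightarrow>\<^sub>m \<psi> \<in> S4 \<Longrightarrow> \<phi> \<in> S4 \<Longrightarrow> \<psi> \<in> S4" for \<phi> \<psi>
    unfolding S4_def by (rule normal_logic.mp)
  then show ?thesis unfolding S4_theory_def by simp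
qed

text \<open>This set acts as the theory generated by \<open>T\<close> and \<open>\<chi>\<close>,
  with the deduction theorem built in, so that derivations from premises need not be
  defined.\<close>

lemma S4_theory_extend:
  assumes "S4_theory T"
  shows "S4_theory {\<psi>. \<chi> \<rightarrow>\<^sub>m \<psi> \<in> T}"
proof -
  have "\<chi> \<rightarrow>\<^sub>m \<phi> \<in> T" if "\<phi> \<in> S4" for \<phi>
  proof -
    have "\<phi> \<rightarrow>\<^sub>m (\<chi> \<rightarrow>\<^sub>m \<phi>) \<in> T" by (rule S4_theory_taut[OF assms]) (simp add: tautology_def)
    then show ?thesis using S4_theoryD[OF assms] that by blast
  qed
  moreover have "\<chi> \<rightarrow>\<^sub>m \<psi> \<in> T" if "\<chi> \<rightarrow>\<^sub>m (\<phi> \<rightarrow>\<^sub>m \<psi>) \<in> T" "\<chi> \<rightarrow>\<^sub>m \<phi> \<in> T" for \<phi> \<psi>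
  proof -
    have "(\<chi> \<rightarrow>\<^sub>m (\<phi> \<rightarrow>\<^sub>m \<psi>)) \<rightarrow>\<^sub>m ((\<chi> \<rightarrow>\<^sub>m \<phi>) \<rightarrow>\<^sub>m (\<chi> \<rightarrow>\<^sub>m \<psi>)) \<in> T"
      by (rule S4_theory_taut[OF assms]) (simp add: tautology_def)
    then show ?thesis using S4_theory_mp[OF assms] that by blast
  qed
  ultimately show ?thesis unfolding S4_theory_def by auto
qed

lemma S4_theory_unbox:
  assumes "S4_theory T"
  shows "S4_theory {\<psi>. \<box> \<psi> \<in> T}"
proof -
  have "\<box> \<psi> \<in> T" if "\<box> (\<phi> \<rightarrow>\<^sub>m \<psi>) \<in> T" "\<box> \<phi> \<in> T" for \<phi> \<psi>
    using S4_theory_mp[OF assms S4_theory_mp[OF assms S4_theory_thm[OF assms S4_K]]] that .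
  moreover have "\<box> \<phi> \<in> T" if "\<phi> \<in> S4" for \<phi>
    using S4_theory_thm[OF assms S4_nec[OF that]] .
  ultimately show ?thesis unfolding S4_theory_def by simp blast
qed

definition max_theory :: "fm set \<Rightarrow> bool" where
  "max_theory M \<longleftrightarrow> S4_theory M \<and> \<bottom>\<^sub>m \<notin> M \<and> (\<forall>\<phi>. \<phi> \<in> M \<or> \<not>\<^sub>m \<phi> \<in> M)"

lemma max_theory_exists:
  assumes "S4_theory T" "\<bottom>\<^sub>m \<notin> T"
  obtains M where "max_theory M" "T \<subseteq> M"
proof -
  let ?A = "{F. S4_theory F \<and> \<bottom>\<^sub>m \<notin> F \<and> T \<subseteq> F}"
  have "\<exists>M\<in>?A. \<forall>F\<in>?A. M \<subseteq> F \<longrightarrow> F = M"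
  proof (rule subset_Zorn_nonempty)
    show "?A \<noteq> {}" using assms by auto
  next
    fix C assume C: "C \<noteq> {}" "subset.chain ?A C"
    have mp: "\<psi> \<in> \<Union>C" if imp: "\<phi> \<rightarrow>\<^sub>m \<psi> \<in> \<Union>C" "\<phi> \<in> \<Union>C" for \<phi> \<psi>
    proof -
      obtain F G where F: "F \<in> C" "G \<in> C" "\<phi> \<rightarrow>\<^sub>m \<psi> \<in> F" "\<phi> \<in> G"
        using imp unfolding Union_iff by blast
      then have "F \<subseteq> G \<or> G \<subseteq> F" using C(2) unfolding subset.chain_def by blast
      then obtain H where "H \<in> C" "\<phi> \<rightarrow>\<^sub>m \<psi> \<in> H" "\<phi> \<in> H" using F by blast
      moreover have "S4_theory H" using \<open>H \<in> C\<close> C(2) unfolding subset.chain_def by blast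
      ultimately show ?thesis using S4_theory_mp by blast
    qed
    obtain F where "F \<in> C" using C(1) by blast
    then have "F \<in> ?A" using C(2) unfolding subset.chain_def by blast
    then have "S4 \<subseteq> \<Union>C" "T \<subseteq> \<Union>C" using \<open>F \<in> C\<close> unfolding S4_theory_def by blast+
    moreover have "\<bottom>\<^sub>m \<notin> \<Union>C" using C(2) unfolding subset.chain_def by blast
    ultimately show "\<Union>C \<in> ?A" using mp unfolding S4_theory_def by blast
  qed
  then obtain M where M: "S4_theory M" "\<bottom>\<^sub>m \<notin> M" "T \<subseteq> M"
    and max: "\<And>F. S4_theory F \<Longrightarrow> \<bottom>\<^sub>m \<notin> F \<Longrightarrow> M \<subseteq> F \<Longrightarrow> F = M"
    by (auto dest: subset_trans)
  have "\<phi> \<in> M \<or> \<not>\<^sub>m \<phi> \<in> M" for \<phi>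
  proof (cases "\<phi> \<rightarrow>\<^sub>m \<bottom>\<^sub>m \<in> M")
    case True
    have "(\<phi> \<rightarrow>\<^sub>m \<bottom>\<^sub>m) \<rightarrow>\<^sub>m \<not>\<^sub>m \<phi> \<in> M"
      by (rule S4_theory_taut[OF M(1)]) (simp add: tautology_def)
    then show ?thesis using S4_theory_mp[OF M(1)] True by blast
  next
    case False
    have "\<psi> \<rightarrow>\<^sub>m (\<phi> \<rightarrow>\<^sub>m \<psi>) \<in> M" for \<psi>
      by (rule S4_theory_taut[OF M(1)]) (simp add: tautology_def)
    then have "M \<subseteq> {\<psi>. \<phi> \<rightarrow>\<^sub>m \<psi> \<in> M}" using S4_theory_mp[OF M(1)] by blast
    \<comment> \<open>The extension of \<open>M\<close> by \<open>\<phi>\<close> omits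
      \<open>\<bottom>\<^sub>m\<close> in this case, so maximality of \<open>M\<close> forces
      equality.\<close>
    then have "{\<psi>. \<phi> \<rightarrow>\<^sub>m \<psi> \<in> M} = M" using max S4_theory_extend[OF M(1)] False by blast
    moreover have "\<phi> \<rightarrow>\<^sub>m \<phi> \<in> M"
      by (rule S4_theory_taut[OF M(1)]) (simp add: tautology_def)
    ultimately show ?thesis by blast
  qed
  then show ?thesis using that M unfolding max_theory_def by blast
qed

context
  fixes M assumes M: "max_theory M"
begin

lemma max_theory_S4: "S4_theory M"
  using M unfolding max_theory_def by blast

lemma max_theory_conseq:
  assumes "tautology (\<phi> \<rightarrow>\<^sub>m \<psi>)" "\<phi> \<in> M" shows "\<psi> \<in> M"
  using S4_theory_mp[OF max_theory_S4] S4_theory_taut[OF max_theory_S4] assms by blast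

lemma max_theory_conseq2:
  assumes "tautology (\<phi> \<rightarrow>\<^sub>m (\<chi> \<rightarrow>\<^sub>m \<psi>))" "\<phi> \<in> M" "\<chi> \<in> M" shows "\<psi> \<in> M"
  using S4_theory_mp[OF max_theory_S4] max_theory_conseq assms by blast

lemma max_theory_Bot: "\<bottom>\<^sub>m \<notin> M"
  using M unfolding max_theory_def by blast

lemma max_theory_Top: "\<top>\<^sub>m \<in> M"
  by (rule S4_theory_taut[OF max_theory_S4]) (simp add: tautology_def)

lemma max_theory_Neg: "\<not>\<^sub>m \<phi> \<in> M \<longleftrightarrow> \<phi> \<notin> M"
proof -
  have "\<bottom>\<^sub>m \<in> M" if "\<not>\<^sub>m \<phi> \<in> M" "\<phi> \<in> M"
    by (rule max_theory_conseq2[OF _ that]) (simp add: tautology_def)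
  then show ?thesis using M max_theory_Bot unfolding max_theory_def by blast
qed

lemma max_theory_And: "\<phi> \<and>\<^sub>m \<psi> \<in> M \<longleftrightarrow> \<phi> \<in> M \<and> \<psi> \<in> M"
proof -
  have "\<phi> \<in> M" if "\<phi> \<and>\<^sub>m \<psi> \<in> M"
    by (rule max_theory_conseq[OF _ that]) (simp add: tautology_def)
  moreover have "\<psi> \<in> M" if "\<phi> \<and>\<^sub>m \<psi> \<in> M"
    by (rule max_theory_conseq[OF _ that]) (simp add: tautology_def)
  moreover have "\<phi> \<and>\<^sub>m \<psi> \<in> M" if "\<phi> \<in> M" "\<psi> \<in> M"
    by (rule max_theory_conseq2[OF _ that]) (simp add: tautology_def)
  ultimately show ?thesis by blast
qed

lemma max_theory_Or: "\<phi> \<or>\<^sub>m \<psi> \<in> M \<longleftrightarrow> \<phi> \<in> M \<or> \<psi> \<in> M"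
proof -
  have "\<phi> \<or>\<^sub>m \<psi> \<in> M" if "\<phi> \<in> M"
    by (rule max_theory_conseq[OF _ that]) (simp add: tautology_def)
  moreover have "\<phi> \<or>\<^sub>m \<psi> \<in> M" if "\<psi> \<in> M"
    by (rule max_theory_conseq[OF _ that]) (simp add: tautology_def)
  moreover have "\<psi> \<in> M" if "\<phi> \<or>\<^sub>m \<psi> \<in> M" "\<not>\<^sub>m \<phi> \<in> M"
    by (rule max_theory_conseq2[OF _ that]) (simp add: tautology_def)
  ultimately show ?thesis unfolding max_theory_Neg by blast
qed

lemma max_theory_Imp: "\<phi> \<rightarrow>\<^sub>m \<psi> \<in> M \<longleftrightarrow> (\<phi> \<in> M \<longrightarrow> \<psi> \<in> M)"
proof -
  have "\<phi> \<rightarrow>\<^sub>m \<psi> \<in> M" if "\<not>\<^sub>m \<phi> \<in> M"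
    by (rule max_theory_conseq[OF _ that]) (simp add: tautology_def)
  moreover have "\<phi> \<rightarrow>\<^sub>m \<psi> \<in> M" if "\<psi> \<in> M"
    by (rule max_theory_conseq[OF _ that]) (simp add: tautology_def)
  ultimately show ?thesis using S4_theory_mp[OF max_theory_S4] unfolding max_theory_Neg by blast
qed

lemma max_theory_Dia: "\<diamond> \<phi> \<in> M \<longleftrightarrow> \<box> \<not>\<^sub>m \<phi> \<notin> M"
  using S4_theory_thm[OF max_theory_S4 S4_dual[of \<phi>]]
  unfolding max_theory_And max_theory_Imp max_theory_Neg by blast

lemma max_theory_Box_T: "\<box> \<phi> \<in> M \<Longrightarrow> \<phi> \<in> M"
  using S4_theory_thm[OF max_theory_S4 S4_T[of \<phi>]] max_theory_Imp by blast

lemma max_theory_Box_4: "\<box> \<phi> \<in> M \<Longrightarrow> \<box> \<box> \<phi> \<in> M"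
  using S4_theory_thm[OF max_theory_S4 S4_4[of \<phi>]] max_theory_Imp by blast

end

text \<open>The formulas boxed in \<open>M\<close> form a theory. Adjoining
  \<open>\<not>\<^sub>m \<phi>\<close> keeps it consistent, since otherwise it would contain
  \<open>\<phi>\<close>, contrary to \<open>\<box> \<phi> \<notin> M\<close>.\<close>

lemma max_theory_successor:
  assumes M: "max_theory M" and "\<box> \<phi> \<notin> M"
  obtains N where "max_theory N" "\<And>\<psi>. \<box> \<psi> \<in> M \<Longrightarrow> \<psi> \<in> N" "\<phi> \<notin> N"
proof -
  let ?B = "{\<psi>. \<box> \<psi> \<in> M}"
  let ?T = "{\<psi>. \<not>\<^sub>m \<phi> \<rightarrow>\<^sub>m \<psi> \<in> ?B}"
  have B: "S4_theory ?B" using S4_theory_unbox[OF max_theory_S4[OF M]] .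
  have "\<bottom>\<^sub>m \<notin> ?T"
  proof
    assume "\<bottom>\<^sub>m \<in> ?T"
    moreover have "(\<not>\<^sub>m \<phi> \<rightarrow>\<^sub>m \<bottom>\<^sub>m) \<rightarrow>\<^sub>m \<phi> \<in> ?B"
      by (rule S4_theory_taut[OF B]) (simp add: tautology_def)
    ultimately have "\<phi> \<in> ?B" using S4_theory_mp[OF B] by blast
    then show False using assms(2) by simp
  qed
  then obtain N where N: "max_theory N" "?T \<subseteq> N"
    using max_theory_exists S4_theory_extend[OF B] by blast
  have "\<psi> \<in> ?T" if "\<psi> \<in> ?B" for \<psi>
  proof -
    have "\<psi> \<rightarrow>\<^sub>m (\<not>\<^sub>m \<phi> \<rightarrow>\<^sub>m \<psi>) \<in> ?B"
      by (rule S4_theory_taut[OF B]) (simp add: tautology_def)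
    then have "\<not>\<^sub>m \<phi> \<rightarrow>\<^sub>m \<psi> \<in> ?B" by (rule S4_theory_mp[OF B]) fact
    then show ?thesis by simp
  qed
  moreover have "\<not>\<^sub>m \<phi> \<in> ?T"
    using S4_theory_taut[OF B, of "\<not>\<^sub>m \<phi> \<rightarrow>\<^sub>m \<not>\<^sub>m \<phi>"] by (simp add: tautology_def)
  ultimately show ?thesis using that[OF N(1)] N(2) max_theory_Neg[OF N(1)] by blast
qed

section \<open>Finite cones by transitive filtration\<close>

primrec subformulas :: "fm \<Rightarrow> fm set" where
  "subformulas (Var n) = {Var n}"
| "subformulas \<bottom>\<^sub>m = {\<bottom>\<^sub>m}"
| "subformulas \<top>\<^sub>m = {\<top>\<^sub>m}"
| "subformulas (\<not>\<^sub>m \<phi>) = insert (\<not>\<^sub>m \<phi>) (subformulas \<phi>)"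
| "subformulas (\<phi> \<and>\<^sub>m \<psi>) = insert (\<phi> \<and>\<^sub>m \<psi>) (subformulas \<phi> \<union> subformulas \<psi>)"
| "subformulas (\<phi> \<or>\<^sub>m \<psi>) = insert (\<phi> \<or>\<^sub>m \<psi>) (subformulas \<phi> \<union> subformulas \<psi>)"
| "subformulas (\<phi> \<rightarrow>\<^sub>m \<psi>) = insert (\<phi> \<rightarrow>\<^sub>m \<psi>) (subformulas \<phi> \<union> subformulas \<psi>)"
| "subformulas (\<diamond> \<phi>) = insert (\<diamond> \<phi>) (subformulas \<phi>)"
| "subformulas (\<box> \<phi>) = insert (\<box> \<phi>) (subformulas \<phi>)"

lemma finite_subformulas: "finite (subformulas \<phi>)"
  by (induction \<phi>) auto

lemma subformulas_refl: "\<phi> \<in> subformulas \<phi>"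
  by (cases \<phi>) auto

text \<open>Passing on whole boxes, rather than their scopes, makes the relation transitive. Worlds
  are all elements of \<open>fm set\<close>, so \<open>X = Y\<close> provides reflexivity also at
  sets that are not traces of maximal theories. Diamonds have their own clause because
  \<open>\<Sigma>\<close> need not contain the dual boxes.\<close>

definition filtration :: "fm set \<Rightarrow> fm set \<Rightarrow> fm set \<Rightarrow> bool" where
  "filtration \<Sigma> X Y \<longleftrightarrow> X = Y \<or>
     (\<exists>N. max_theory N \<and> Y = N \<inter> \<Sigma>) \<and>
     (\<forall>\<chi>. \<box> \<chi> \<in> \<Sigma> \<longrightarrow> \<box> \<chi> \<in> X \<longrightarrow> \<box> \<chi> \<in> Y) \<and>
     (\<forall>\<chi>. \<diamond> \<chi> \<in> \<Sigma> \<longrightarrow> \<diamond> \<chi> \<in> Y \<longrightarrow> \<diamond> \<chi> \<in> X)"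

lemma reflp_filtration: "reflp (filtration \<Sigma>)"
  by (auto simp: reflp_def filtration_def)

lemma transp_filtration: "transp (filtration \<Sigma>)"
  unfolding transp_def filtration_def by blast

lemma finite_filtration:
  assumes "finite \<Sigma>"
  shows "finite {Y. filtration \<Sigma> X Y}"
proof (rule finite_subset)
  show "{Y. filtration \<Sigma> X Y} \<subseteq> insert X (Pow \<Sigma>)" by (auto simp: filtration_def)
  show "finite (insert X (Pow \<Sigma>))" using assms by simp
qed

lemma filtration_successor:
  assumes M: "max_theory M" and N: "max_theory N" and "\<And>\<psi>. \<box> \<psi> \<in> M \<Longrightarrow> \<psi> \<in> N"
  shows "filtration \<Sigma> (M \<inter> \<Sigma>) (N \<inter> \<Sigma>)"
proof -
  \<comment> \<open>Axiom 4 puts \<open>\<box> \<box> \<chi>\<close> into \<open>M\<close>, so the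
    hypothesis hands down the box itself and not only its scope.\<close>
  have box: "\<box> \<chi> \<in> M \<Longrightarrow> \<box> \<chi> \<in> N" for \<chi>
    using assms(3) max_theory_Box_4[OF M] by blast
  then have "\<diamond> \<chi> \<in> N \<Longrightarrow> \<diamond> \<chi> \<in> M" for \<chi>
    using max_theory_Dia[OF M] max_theory_Dia[OF N] by blast
  then show ?thesis using box N unfolding filtration_def by blast
qed

lemma filtration_cases:
  assumes "filtration \<Sigma> (M \<inter> \<Sigma>) Y" "max_theory M"
  obtains N where "max_theory N" "Y = N \<inter> \<Sigma>"
    "\<And>\<chi>. \<box> \<chi> \<in> \<Sigma> \<Longrightarrow> \<box> \<chi> \<in> M \<Longrightarrow> \<box> \<chi> \<in> N"
    "\<And>\<chi>. \<diamond> \<chi> \<in> \<Sigma> \<Longrightarrow> \<diamond> \<chi> \<in> N \<Longrightarrow> \<diamond> \<chi> \<in> M"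
proof (cases "M \<inter> \<Sigma> = Y")
  case True
  then show ?thesis using assms(2) that[of M] by blast
next
  case False
  then obtain N where "max_theory N" "Y = N \<inter> \<Sigma>"
    "\<forall>\<chi>. \<box> \<chi> \<in> \<Sigma> \<longrightarrow> \<box> \<chi> \<in> M \<inter> \<Sigma> \<longrightarrow> \<box> \<chi> \<in> N \<inter> \<Sigma>"
    "\<forall>\<chi>. \<diamond> \<chi> \<in> \<Sigma> \<longrightarrow> \<diamond> \<chi> \<in> N \<inter> \<Sigma> \<longrightarrow> \<diamond> \<chi> \<in> M \<inter> \<Sigma>"
    using assms(1) unfolding filtration_def by blast
  then show ?thesis using that by blast
qed

lemma filtration_truth:
  "subformulas \<phi> \<subseteq> \<Sigma> \<Longrightarrow> max_theory M \<Longrightarrow>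
    M \<inter> \<Sigma> \<in> ext (filtration \<Sigma>) (\<lambda>n. {X. Var n \<in> X}) \<phi> \<longleftrightarrow> \<phi> \<in> M"
proof (induction \<phi> arbitrary: M)
  case (Dia \<phi>)
  let ?E = "ext (filtration \<Sigma>) (\<lambda>n. {X. Var n \<in> X})"
  note M = Dia.prems(2)
  have IH: "N \<inter> \<Sigma> \<in> ?E \<phi> \<longleftrightarrow> \<phi> \<in> N" if "max_theory N" for N
    using Dia.IH Dia.prems(1) that by simp
  show ?case
  proof
    assume "M \<inter> \<Sigma> \<in> ?E (\<diamond> \<phi>)"
    then obtain Y where Y: "filtration \<Sigma> (M \<inter> \<Sigma>) Y" "Y \<in> ?E \<phi>" by auto
    obtain N where N: "max_theory N" "Y = N \<inter> \<Sigma>" "\<diamond> \<phi> \<in> N \<Longrightarrow> \<diamond> \<phi> \<in> M"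
      using filtration_cases[OF Y(1) M] Dia.prems(1) by (metis insert_subset subformulas.simps(8))
    have "\<phi> \<in> N" using Y(2) N IH by blast
    \<comment> \<open>Axiom T turns \<open>\<phi> \<in> N\<close> into
      \<open>\<diamond> \<phi> \<in> N\<close>, and diamonds descend along the filtration.\<close>
    then have "\<box> \<not>\<^sub>m \<phi> \<notin> N" using max_theory_Box_T[OF N(1)] max_theory_Neg[OF N(1)] by blast
    then show "\<diamond> \<phi> \<in> M" using N(3) max_theory_Dia[OF N(1)] by blast
  next
    assume "\<diamond> \<phi> \<in> M"
    then have "\<box> \<not>\<^sub>m \<phi> \<notin> M" using max_theory_Dia[OF M] by blast
    then obtain N where N: "max_theory N" "\<And>\<psi>. \<box> \<psi> \<in> M \<Longrightarrow> \<psi> \<in> N" "\<not>\<^sub>m \<phi> \<notin> N"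
      using max_theory_successor[OF M] by blast
    then have "N \<inter> \<Sigma> \<in> ?E \<phi>" using IH max_theory_Neg[OF N(1)] by blast
    moreover have "filtration \<Sigma> (M \<inter> \<Sigma>) (N \<inter> \<Sigma>)" using filtration_successor[OF M N(1,2)] .
    ultimately show "M \<inter> \<Sigma> \<in> ?E (\<diamond> \<phi>)" by auto
  qed
next
  case (Box \<phi>)
  let ?E = "ext (filtration \<Sigma>) (\<lambda>n. {X. Var n \<in> X})"
  note M = Box.prems(2)
  have IH: "N \<inter> \<Sigma> \<in> ?E \<phi> \<longleftrightarrow> \<phi> \<in> N" if "max_theory N" for N
    using Box.IH Box.prems(1) that by simp
  show ?case
  proof
    assume *: "M \<inter> \<Sigma> \<in> ?E (\<box> \<phi>)"
    show "\<box> \<phi> \<in> M"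
    proof (rule ccontr)
      assume "\<box> \<phi> \<notin> M"
      then obtain N where N: "max_theory N" "\<And>\<psi>. \<box> \<psi> \<in> M \<Longrightarrow> \<psi> \<in> N" "\<phi> \<notin> N"
        using max_theory_successor[OF M] by blast
      then show False using * IH filtration_successor[OF M N(1,2)] by auto
    qed
  next
    assume "\<box> \<phi> \<in> M"
    have "Y \<in> ?E \<phi>" if Y: "filtration \<Sigma> (M \<inter> \<Sigma>) Y" for Y
    proof -
      obtain N where N: "max_theory N" "Y = N \<inter> \<Sigma>" "\<box> \<phi> \<in> M \<Longrightarrow> \<box> \<phi> \<in> N"
        using filtration_cases[OF Y M] Box.prems(1) by (metis insert_subset subformulas.simps(9))
      then show ?thesis using IH \<open>\<box> \<phi> \<in> M\<close> max_theory_Box_T[OF N(1)] by blast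
    qed
    then show "M \<inter> \<Sigma> \<in> ?E (\<box> \<phi>)" by simp
  qed
qed (auto simp: max_theory_Bot max_theory_Top max_theory_Neg max_theory_And max_theory_Or
    max_theory_Imp)

text \<open>The countermodel has the infinite type \<open>fm set\<close> as its set of worlds, hence
  finiteness is stated for the cones \<open>{y. R x y}\<close> and not for the frame.\<close>

theorem S4_complete:
  assumes "\<And>(R :: fm set \<Rightarrow> fm set \<Rightarrow> bool) V.
    reflp R \<Longrightarrow> transp R \<Longrightarrow> (\<And>x. finite {y. R x y}) \<Longrightarrow> ext R V \<phi> = UNIV"
  shows "\<phi> \<in> S4"
proof (rule ccontr)
  assume "\<phi> \<notin> S4"
  let ?T = "{\<psi>. \<not>\<^sub>m \<phi> \<rightarrow>\<^sub>m \<psi> \<in> S4}"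
  have "\<bottom>\<^sub>m \<notin> ?T"
  proof
    assume "\<bottom>\<^sub>m \<in> ?T"
    moreover have "(\<not>\<^sub>m \<phi> \<rightarrow>\<^sub>m \<bottom>\<^sub>m) \<rightarrow>\<^sub>m \<phi> \<in> S4"
      by (rule S4_taut) (simp add: tautology_def)
    ultimately show False using S4_theory_mp[OF S4_theory_S4] \<open>\<phi> \<notin> S4\<close> by blast
  qed
  then obtain M where M: "max_theory M" "?T \<subseteq> M"
    using max_theory_exists S4_theory_extend[OF S4_theory_S4] by blast
  have "\<not>\<^sub>m \<phi> \<in> ?T" using S4_taut[of "\<not>\<^sub>m \<phi> \<rightarrow>\<^sub>m \<not>\<^sub>m \<phi>"] by (simp add: tautology_def)
  then have "\<phi> \<notin> M" using M max_theory_Neg[OF M(1)] by blast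
  then show False
    using filtration_truth[OF order.refl M(1), of \<phi>] assms[OF reflp_filtration transp_filtration
        finite_filtration[OF finite_subformulas[of \<phi>]]] by blast
qed

section \<open>Additive formulas as operators\<close>

text \<open>The constant valuation keeps \<open>p\<close> out of the operator; on
  \<open>Fm p\<close> it agrees with reading \<open>p\<close> as \<open>A\<close>.\<close>

definition oper :: "fm \<Rightarrow> ('w \<Rightarrow> 'w \<Rightarrow> bool) \<Rightarrow> 'w set \<Rightarrow> 'w set" where
  "oper \<phi> R A = ext R (\<lambda>_. A) \<phi>"

lemma ext_eq_oper: "\<phi> \<in> Fm p \<Longrightarrow> ext R V \<phi> = oper \<phi> R (V p)"
  unfolding oper_def Fm_def by (rule ext_cong_vars) auto

lemma ext_inst: "\<phi> \<in> Fm p \<Longrightarrow> ext R V (inst p \<phi> \<chi>) = oper \<phi> R (ext R V \<chi>)"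
  by (simp add: inst_def ext_subst ext_eq_oper)

lemma oper_p_morphism: "p_morphism f R S \<Longrightarrow> oper \<phi> R (f -` A) = f -` oper \<phi> S A"
  unfolding oper_def using ext_p_morphism[of f R S "\<lambda>_. A"] .

lemma oper_cong_upset:
  assumes "reflp R" "transp R" "\<And>y. R x y \<Longrightarrow> y \<in> A \<longleftrightarrow> y \<in> B"
  shows "x \<in> oper \<phi> R A \<longleftrightarrow> x \<in> oper \<phi> R B"
  unfolding oper_def
proof (rule ext_cong_upset[where U = "{y. R x y}"])
  show "x \<in> {y. R x y}" using assms(1) by (simp add: reflpD)
  show "z \<in> {y. R x y}" if "y \<in> {y. R x y}" "R y z" for y z
    using assms(2) that unfolding transp_def by blast
qed (use assms(3) in auto)

lemma S4_Iff_iff_ext: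
  "(\<phi> \<leftrightarrow>\<^sub>m \<psi>) \<in> S4 \<longleftrightarrow> (\<forall>(R :: fm set \<Rightarrow> fm set \<Rightarrow> bool) V.
    reflp R \<longrightarrow> transp R \<longrightarrow> (\<forall>x. finite {y. R x y}) \<longrightarrow> ext R V \<phi> = ext R V \<psi>)"
  (is "?L \<longleftrightarrow> ?R")
proof
  assume ?L
  then show ?R using S4_sound[OF \<open>?L\<close>] by auto
next
  assume R: ?R
  show ?L
    by (rule S4_complete) (use R in auto)
qed

text \<open>Complements the characterization above, which speaks of frames on \<open>fm set\<close>
  only, whereas the small test frames live on other types.\<close>

lemma S4_Iff_sound:
  assumes "(\<phi> \<leftrightarrow>\<^sub>m \<psi>) \<in> S4" "reflp R" "transp R"
  shows "ext R V \<phi> = ext R V \<psi>"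
  using S4_sound[OF assms] by auto

section \<open>Small test frames and doubling\<close>

abbreviation point :: "unit \<Rightarrow> unit \<Rightarrow> bool" where
  "point x y \<equiv> True"

abbreviation cluster :: "bool \<Rightarrow> bool \<Rightarrow> bool" where
  "cluster x y \<equiv> True"

text \<open>A two-element cluster below the single maximal point \<open>None\<close>.\<close>

definition capped :: "bool option \<Rightarrow> bool option \<Rightarrow> bool" where
  "capped x y \<longleftrightarrow> x \<noteq> None \<or> y = None"

text \<open>The root \<open>None\<close> below two maximal two-element clusters.\<close>

definition fork :: "(bool \<times> bool) option \<Rightarrow> (bool \<times> bool) option \<Rightarrow> bool" where
  "fork x y \<longleftrightarrow> x = None \<or> (y \<noteq> None \<and> fst (the x) = fst (the y))"

definition double :: "('w \<Rightarrow> 'w \<Rightarrow> bool) \<Rightarrow> 'w \<times> bool \<Rightarrow> 'w \<times> bool \<Rightarrow> bool" where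
  "double R x y \<longleftrightarrow> R (fst x) (fst y)"

lemma preorder_point: "reflp point" "transp point"
  and preorder_cluster: "reflp cluster" "transp cluster"
  and preorder_capped: "reflp capped" "transp capped"
  and preorder_fork: "reflp fork" "transp fork"
  unfolding reflp_def transp_def capped_def fork_def by blast+

lemma preorder_double:
  "reflp R \<Longrightarrow> reflp (double R)" "transp R \<Longrightarrow> transp (double R)"
  by (auto simp: double_def reflp_def transp_def)

lemma finite_double: "finite {y. R (fst x) y} \<Longrightarrow> finite {y. double R x y}"
proof -
  have "{y. double R x y} = {y. R (fst x) y} \<times> UNIV" by (auto simp: double_def)
  then show "finite {y. R (fst x) y} \<Longrightarrow> finite {y. double R x y}" by simp
qed

text \<open>Every reflexive frame collapses to one point by a p-morphism, so the value at the empty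
  set is everything or nothing, in the same way for all frames.\<close>

lemma oper_empty_point:
  assumes "reflp R"
  shows "oper \<phi> R {} = (if () \<in> oper \<phi> point {} then UNIV else {})"
proof -
  have "p_morphism (\<lambda>_. ()) R point"
    using assms by (auto simp: p_morphism_def reflp_def)
  from oper_p_morphism[OF this, of \<phi> "{}"] show ?thesis by auto
qed

section \<open>Reduction to singletons\<close>

locale additive_formula =
  fixes p q :: nat and \<phi> :: fm
  assumes neq: "p \<noteq> q" and Fm: "\<phi> \<in> Fm p" and additive: "additive_in S4 p q \<phi>"
begin

lemma oper_Un:
  assumes "reflp R" "transp R"
  shows "oper \<phi> R (A \<union> B) = oper \<phi> R A \<union> oper \<phi> R B"
  using S4_Iff_sound[OF additive[unfolded additive_in_def] assms, of "(\<lambda>_. A)(q := B)"] neq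
  by (simp add: ext_inst[OF Fm])

lemma oper_UNIV:
  assumes "reflp R" "transp R" "() \<in> oper \<phi> point {}"
  shows "oper \<phi> R A = UNIV"
  using oper_Un[OF assms(1,2), of "{}" A] oper_empty_point[OF assms(1), of \<phi>] assms(3) by simp

end

locale normal_additive_formula = additive_formula +
  assumes normal: "() \<notin> oper \<phi> point {}"
begin

lemma oper_empty: "reflp R \<Longrightarrow> oper \<phi> R {} = {}"
  using oper_empty_point[of R \<phi>] normal by simp

lemma oper_singleton_le:
  assumes "reflp R" "transp R" "x \<in> oper \<phi> R {a}"
  shows "R x a"
proof (rule ccontr)
  assume "\<not> R x a"
  then have "x \<in> oper \<phi> R {}"
    using oper_cong_upset[OF assms(1,2), of x "{a}" "{}" \<phi>] assms(3) by blast
  then show False using oper_empty[OF assms(1)] by simp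
qed

lemma oper_iff_singletons:
  assumes "reflp R" "transp R" "finite {y. R x y}"
  shows "x \<in> oper \<phi> R A \<longleftrightarrow> (\<exists>a\<in>A. x \<in> oper \<phi> R {a})"
proof -
  have fin: "x \<in> oper \<phi> R B \<longleftrightarrow> (\<exists>a\<in>B. x \<in> oper \<phi> R {a})" if "finite B" for B
    using that
  proof induction
    case empty
    then show ?case using oper_empty[OF assms(1)] by simp
  next
    case (insert b B)
    then show ?case using oper_Un[OF assms(1,2), of "{b}" B] by simp
  qed
  \<comment> \<open>Cutting \<open>A\<close> down to the finite cone of \<open>x\<close> makes
    \<open>fin\<close> applicable.\<close>
  have "x \<in> oper \<phi> R A \<longleftrightarrow> x \<in> oper \<phi> R (A \<inter> {y. R x y})"
    by (rule oper_cong_upset[OF assms(1,2)]) auto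
  also have "\<dots> \<longleftrightarrow> (\<exists>a\<in>A \<inter> {y. R x y}. x \<in> oper \<phi> R {a})"
    by (rule fin) (use assms(3) in simp)
  finally show ?thesis using oper_singleton_le[OF assms(1,2)] by blast
qed

lemma oper_singleton_p_morphism:
  assumes "p_morphism f R S" "reflp R" "transp R" "finite {y. R x y}"
  shows "f x \<in> oper \<phi> S {c} \<longleftrightarrow> (\<exists>b. f b = c \<and> x \<in> oper \<phi> R {b})"
proof -
  have "f x \<in> oper \<phi> S {c} \<longleftrightarrow> x \<in> oper \<phi> R (f -` {c})"
    using oper_p_morphism[OF assms(1)] by blast
  also have "\<dots> \<longleftrightarrow> (\<exists>b\<in>f -` {c}. x \<in> oper \<phi> R {b})"
    by (rule oper_iff_singletons[OF assms(2-4)])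
  finally show ?thesis by blast
qed

lemma oper_singleton_p_morphism_unique:
  assumes "p_morphism f R S" "\<And>b. f b = c \<longleftrightarrow> b = a"
  shows "x \<in> oper \<phi> R {a} \<longleftrightarrow> f x \<in> oper \<phi> S {c}"
proof -
  have "f -` {c} = {a}" using assms(2) by auto
  then show ?thesis using oper_p_morphism[OF assms(1), of \<phi> "{c}"] by auto
qed

text \<open>The projection \<open>fst\<close> is a p-morphism whose fibre over \<open>a\<close>
  consists of both copies. Of the two preimages of \<open>x\<close>, \<open>(x, False)\<close> is
  fixed throughout.\<close>

lemma oper_double:
  assumes "reflp R" "transp R" "finite {y. R x y}"
  shows "x \<in> oper \<phi> R {a} \<longleftrightarrow> (\<exists>j. (x, False) \<in> oper \<phi> (double R) {(a, j)})"
proof -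
  have "p_morphism fst (double R) R"
    by (auto simp: p_morphism_def double_def)
  from oper_singleton_p_morphism[OF this preorder_double(1)[OF assms(1)]
      preorder_double(2)[OF assms(2)] finite_double, of "(x, False)" a]
  show ?thesis using assms(3) by auto
qed

section \<open>The value on a singleton\<close>

abbreviation (input) "s \<equiv> False \<in> oper \<phi> cluster {True}"
abbreviation (input) "r \<equiv> True \<in> oper \<phi> cluster {True}"
abbreviation (input) "d \<equiv> Some False \<in> oper \<phi> capped {Some True}"
abbreviation (input) "e \<equiv> Some True \<in> oper \<phi> capped {Some True}"

lemma fork_cluster:
  "Some (True, False) \<in> oper \<phi> fork {Some (True, True)} \<longleftrightarrow> s"
  "Some (True, True) \<in> oper \<phi> fork {Some (True, True)} \<longleftrightarrow> r"
proof -
  have "p_morphism (\<lambda>k. Some (True, k)) cluster fork"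
    by (auto simp: p_morphism_def fork_def)
  from oper_singleton_p_morphism_unique[OF this, of "Some (True, True)" True]
  show "Some (True, False) \<in> oper \<phi> fork {Some (True, True)} \<longleftrightarrow> s"
    "Some (True, True) \<in> oper \<phi> fork {Some (True, True)} \<longleftrightarrow> r" by auto
qed

text \<open>Folding the fork onto the cluster, with \<open>None\<close> over \<open>False\<close>,
  makes \<open>s\<close> the disjunction of the values at the root for one point in each arm.
  Swapping the arms shows that both disjuncts agree.\<close>

lemma fork_root: "None \<in> oper \<phi> fork {Some (True, True)} \<longleftrightarrow> s"
proof -
  let ?h = "\<lambda>x. case x of None \<Rightarrow> False | Some (b, k) \<Rightarrow> k"
  let ?t = "map_option (apfst Not)"
  have "p_morphism ?h fork cluster"
    unfolding p_morphism_def fork_def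
    by (auto split: option.splits simp: split_option_ex ex_bool_eq)
  from oper_singleton_p_morphism[OF this preorder_fork, of None True]
  have "s \<longleftrightarrow> (\<exists>x. ?h x \<and> None \<in> oper \<phi> fork {x})"
    by simp
  then have "s \<longleftrightarrow> (\<exists>b. None \<in> oper \<phi> fork {Some (b, True)})"
    by (simp add: split_option_ex ex_bool_eq)
  moreover have "p_morphism ?t fork fork"
    unfolding p_morphism_def fork_def
    by (auto simp: split_option_ex split_option_all ex_bool_eq)
  from oper_singleton_p_morphism_unique[OF this, of "Some (True, True)" "Some (False, True)" None]
  have "None \<in> oper \<phi> fork {Some (False, True)} \<longleftrightarrow> None \<in> oper \<phi> fork {Some (True, True)}"
    by (auto simp: apfst_def map_prod_def split: prod.splits)
  ultimately show ?thesis by (auto simp: ex_bool_eq)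
qed

text \<open>If \<open>(a, j)\<close> is to be a whole fibre, points not seeing \<open>a\<close>
  cannot lie over the cluster containing its image. They go to a second cluster, and points seeing
  both \<open>a\<close> and some such point go to a root below the two: this is the fork.\<close>

lemma oper_singleton_maximal:
  fixes R :: "'w \<Rightarrow> 'w \<Rightarrow> bool"
  assumes "reflp R" "transp R" "finite {y. R x y}" "R x a" and max: "\<And>y. R a y \<Longrightarrow> R y a"
  shows "x \<in> oper \<phi> R {a} \<longleftrightarrow> s \<or> (x = a \<and> r)"
proof -
  have refl: "R y y" and trans: "R y z \<Longrightarrow> R z u \<Longrightarrow> R y u" for y z u
    using assms(1,2) unfolding reflp_def transp_def by blast+
  \<comment> \<open>\<open>Q\<close> holds where \<open>a\<close> can never be lost from sight; by
    maximality it holds at \<open>a\<close>.\<close>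
  define Q where "Q y \<longleftrightarrow> (\<forall>z. R y z \<longrightarrow> R z a)" for y
  have Q_a: "Q a" and Q_up: "R y z \<Longrightarrow> Q y \<Longrightarrow> Q z"
    and le_a: "R y z \<Longrightarrow> Q y \<Longrightarrow> R z a" for y z
    using max trans unfolding Q_def by blast+
  have "(x, False) \<in> oper \<phi> (double R) {(a, j)} \<longleftrightarrow> (if x = a \<and> \<not> j then r else s)" for j
  proof -
    let ?g = "\<lambda>(y, k). if \<not> R y a then Some (False, k)
      else if Q y then Some (True, y = a \<and> k = j) else None"
    \<comment> \<open>The label \<open>i = j\<close> equals \<open>j\<close> exactly if
      \<open>i\<close> holds, so \<open>(a, i = j)\<close> is the copy of \<open>a\<close> lying
      over the point labelled \<open>i\<close>.\<close>
    have g_a: "?g (a, i = j) = Some (True, i)" for i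
      using refl[of a] Q_a by auto
    have "p_morphism ?g (double R) fork"
      unfolding p_morphism_def
    proof (intro conjI allI impI)
      fix u v :: "'w \<times> bool" assume "double R u v"
      then have uv: "R (fst u) (fst v)" by (simp add: double_def)
      have "R (fst v) a \<Longrightarrow> R (fst u) a" "Q (fst u) \<Longrightarrow> R (fst v) a" "Q (fst u) \<Longrightarrow> Q (fst v)"
        using uv trans[OF uv] le_a[OF uv] Q_up[OF uv] by simp_all
      then show "fork (?g u) (?g v)"
        by (cases "R (fst u) a"; cases "R (fst v) a"; cases "Q (fst u)"; cases "Q (fst v)")
          (simp_all add: fork_def split_beta)
    next
      fix u :: "'w \<times> bool" and c assume uc: "fork (?g u) c"
      obtain y k where u: "u = (y, k)" by (cases u)
      consider "\<not> R y a" | "R y a" "Q y" | z where "R y a" "\<not> Q y" "R y z" "\<not> R z a"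
        unfolding Q_def by blast
      then have "\<exists>w i. R y w \<and> ?g (w, i) = c"
      proof cases
        case 1
        then obtain i where "c = Some (False, i)" using uc u by (cases c) (auto simp: fork_def)
        then have "R y y \<and> ?g (y, i) = c" using 1 refl[of y] by simp
        then show ?thesis by blast
      next
        case 2
        then obtain i where "c = Some (True, i)" using uc u by (cases c) (auto simp: fork_def)
        then show ?thesis using 2(1) g_a[of i] by blast
      next
        case 3
        show ?thesis
        proof (cases c)
          case None
          then have "R y y \<and> ?g (y, True) = c" using 3 refl[of y] by simp
          then show ?thesis by blast
        next
          case (Some c')
          obtain b i where c: "c = Some (b, i)" using Some by (cases c') simp
          show ?thesis
          proof (cases b)
            case True
            then have "?g (a, i = j) = c" using c g_a[of i] by simp
            then show ?thesis using 3(1) by blast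
          next
            case False
            then have "R y z \<and> ?g (z, i) = c" using 3 c by simp
            then show ?thesis by blast
          qed
        qed
      qed
      then show "\<exists>w. double R u w \<and> ?g w = c" using u by (simp add: double_def)
    qed
    moreover have "?g b = Some (True, True) \<longleftrightarrow> b = (a, j)" for b
      using refl[of a] Q_a by (cases b) (auto split: if_splits)
    ultimately have "(x, False) \<in> oper \<phi> (double R) {(a, j)} \<longleftrightarrow>
        ?g (x, False) \<in> oper \<phi> fork {Some (True, True)}"
      by (rule oper_singleton_p_morphism_unique)
    \<comment> \<open>Unless \<open>(x, False)\<close> is \<open>(a, j)\<close>, it lies over
      \<open>Some (True, False)\<close> or, when \<open>Q x\<close> fails, over the root; both have
      value \<open>s\<close>.\<close>
    then show ?thesis using fork_cluster fork_root assms(4) Q_a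
      by (cases "x = a"; cases j; cases "Q x") simp_all
  qed
  then show ?thesis using oper_double[OF assms(1-3), of a] by (auto simp: ex_bool_eq)
qed

text \<open>Points not seeing \<open>a\<close> form an upset and collapse to \<open>None\<close>.
  All points below \<open>a\<close> see both copies of \<open>a\<close> as well as \<open>y\<close>,
  which lies over the cap, so they fit into a single cluster.\<close>

lemma oper_singleton_nonmaximal:
  fixes R :: "'w \<Rightarrow> 'w \<Rightarrow> bool"
  assumes "reflp R" "transp R" "finite {y. R x y}" "R x a" and nonmax: "R a y" "\<not> R y a"
  shows "x \<in> oper \<phi> R {a} \<longleftrightarrow> d \<or> (x = a \<and> e)"
proof -
  have refl: "R y y" and trans: "R y z \<Longrightarrow> R z u \<Longrightarrow> R y u" for y z u
    using assms(1,2) unfolding reflp_def transp_def by blast+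
  have "(x, False) \<in> oper \<phi> (double R) {(a, j)} \<longleftrightarrow> (if x = a \<and> \<not> j then e else d)" for j
  proof -
    let ?g = "\<lambda>(y, k). if R y a then Some (y = a \<and> k = j) else None"
    have "p_morphism ?g (double R) capped"
      unfolding p_morphism_def
    proof (intro conjI allI impI)
      fix u v :: "'w \<times> bool" assume "double R u v"
      then have "R (fst u) a" if "R (fst v) a" using trans that unfolding double_def by blast
      then show "capped (?g u) (?g v)"
        by (auto simp: capped_def split: prod.splits)
    next
      fix u :: "'w \<times> bool" and c assume uc: "capped (?g u) c"
      obtain x' k where u: "u = (x', k)" by (cases u)
      have "\<exists>w i. R x' w \<and> ?g (w, i) = c"
      proof (cases "R x' a")
        case False
        then show ?thesis using uc u refl by (auto simp: capped_def)
      next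
        case True
        show ?thesis
        proof (cases c)
          case None
          then show ?thesis using True nonmax trans by auto
        next
          case (Some i)
          \<comment> \<open>The copy \<open>(a, j)\<close> lies over \<open>Some True\<close>, its
            twin over \<open>Some False\<close>.\<close>
          then show ?thesis using True refl
            by (intro exI[of _ a] exI[of _ "if i then j else \<not> j"]) auto
        qed
      qed
      then show "\<exists>w. double R u w \<and> ?g w = c" using u by (simp add: double_def)
    qed
    moreover have "?g b = Some True \<longleftrightarrow> b = (a, j)" for b
      using refl by (cases b) (auto split: if_splits)
    ultimately have "(x, False) \<in> oper \<phi> (double R) {(a, j)} \<longleftrightarrow>
        ?g (x, False) \<in> oper \<phi> capped {Some True}"
      by (rule oper_singleton_p_morphism_unique)
    then show ?thesis using assms(4) by (cases "x = a"; cases j) simp_all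
  qed
  then show ?thesis using oper_double[OF assms(1-3), of a] by (auto simp: ex_bool_eq)
qed

text \<open>The capped frame is mapped onto a cluster after doubling, which lets the cap carry both
  labels. The fibre over \<open>True\<close> contains \<open>(Some True, j)\<close>, and this point
  alone already yields \<open>s\<close>.\<close>

lemma capped_imp_cluster: "d \<Longrightarrow> s"
proof -
  assume d
  then obtain j where j: "(Some False, False) \<in> oper \<phi> (double capped) {(Some True, j)}"
    using oper_double[OF preorder_capped, of "Some False" "Some True"] by auto
  \<comment> \<open>Every point sees both copies of \<open>None\<close>, hence both labels. The
    labels on the copies of \<open>Some True\<close> are adjusted so that \<open>j\<close> becomes
    \<open>True\<close>.\<close>
  let ?g = "\<lambda>(y, k). if y = Some True then k = j else k"
  have "p_morphism ?g (double capped) cluster"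
    unfolding p_morphism_def
  proof (intro conjI allI impI TrueI)
    fix u :: "bool option \<times> bool" and c :: bool
    have "double capped u (None, c)" by (simp add: double_def capped_def)
    then show "\<exists>w. double capped u w \<and> ?g w = c" by (intro exI[of _ "(None, c)"]) simp
  qed
  from oper_singleton_p_morphism[OF this preorder_double(1)[OF preorder_capped(1)]
      preorder_double(2)[OF preorder_capped(2)], of "(Some False, False)" True]
  show s using j by auto
qed

text \<open>Both frames collapse to one point, and both sides compute the value of the full set
  there. In the capped frame the points of the cluster contribute \<open>e\<close> and, by symmetry,
  \<open>d\<close>; the cap is maximal and contributes \<open>s\<close>.\<close>

lemma capped_or_cluster_iff: "e \<or> d \<or> s \<longleftrightarrow> r \<or> s"
proof -
  have "p_morphism (\<lambda>_. ()) capped point" "p_morphism (\<lambda>_. ()) cluster point"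
    by (auto simp: p_morphism_def capped_def)
  note m = this[THEN oper_singleton_p_morphism]
  have "() \<in> oper \<phi> point {()} \<longleftrightarrow> (\<exists>b. Some True \<in> oper \<phi> capped {b})"
    using m(1)[OF preorder_capped, where x = "Some True" and c = "()"] by simp
  moreover have "() \<in> oper \<phi> point {()} \<longleftrightarrow> (\<exists>b. True \<in> oper \<phi> cluster {b})"
    using m(2)[OF preorder_cluster, where x = True and c = "()"] by simp
  moreover have "Some True \<in> oper \<phi> capped {None} \<longleftrightarrow> s"
    using oper_singleton_maximal[OF preorder_capped, of "Some True" None]
    by (auto simp: capped_def)
  moreover have "Some True \<in> oper \<phi> capped {Some False} \<longleftrightarrow> d"
    using oper_singleton_p_morphism_unique[of "map_option Not" capped capped "Some True"
        "Some False" "Some True"]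
    by (auto simp: p_morphism_def capped_def split_option_ex split_option_all)
  moreover have "True \<in> oper \<phi> cluster {False} \<longleftrightarrow> s"
    using oper_singleton_p_morphism_unique[of Not cluster cluster True False True]
    by (auto simp: p_morphism_def)
  ultimately show ?thesis by (auto simp: split_option_ex ex_bool_eq)
qed

end

section \<open>Classification by profiles\<close>

text \<open>The disjunctions stem from the doubled frame, in which a singleton's preimage contains both
  the point itself and a different point of its cluster.\<close>

definition profile :: "fm \<Rightarrow> bool \<times> bool \<times> bool \<times> bool \<times> bool" where
  "profile \<phi> =
    (() \<in> oper \<phi> point {},
     False \<in> oper \<phi> cluster {True},
     False \<in> oper \<phi> cluster {True} \<or> True \<in> oper \<phi> cluster {True},
     Some False \<in> oper \<phi> capped {Some True},
     Some False \<in> oper \<phi> capped {Some True} \<or> Some True \<in> oper \<phi> capped {Some True})"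

text \<open>The profile fixes the values on singletons, hence the operator on all frames with finite
  cones, and completeness does the rest.\<close>

lemma equivalent_if_profile_eq:
  assumes "additive_formula p q \<phi>" "additive_formula p q \<psi>" "profile \<phi> = profile \<psi>"
  shows "equivalent S4 \<phi> \<psi>"
proof -
  interpret \<phi>: additive_formula p q \<phi> by fact
  interpret \<psi>: additive_formula p q \<psi> by fact
  note prof = assms(3)[unfolded profile_def prod.inject]
  have "oper \<phi> R A = oper \<psi> R A"
    if R: "reflp R" "transp R" and fin: "\<And>x. finite {y. R x y}"
    for R :: "fm set \<Rightarrow> fm set \<Rightarrow> bool" and A
  proof (cases "() \<in> oper \<phi> point {}")
    case True
    then have "() \<in> oper \<psi> point {}" using prof by blast
    then show ?thesis using \<phi>.oper_UNIV[OF R True] \<psi>.oper_UNIV[OF R] by simp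
  next
    case False
    then interpret \<phi>: normal_additive_formula p q \<phi> by unfold_locales
    interpret \<psi>: normal_additive_formula p q \<psi>
      using False prof by unfold_locales blast
    have single: "x \<in> oper \<phi> R {a} \<longleftrightarrow> x \<in> oper \<psi> R {a}" for x a
    proof (cases "R x a")
      case True
      show ?thesis
      proof (cases "\<forall>y. R a y \<longrightarrow> R y a")
        case max: True
        note m = max[rule_format]
        show ?thesis
          using \<phi>.oper_singleton_maximal[OF R fin True m] \<psi>.oper_singleton_maximal[OF R fin True m]
            prof by blast
      next
        case False
        then obtain y where y: "R a y" "\<not> R y a" by blast
        show ?thesis
          using \<phi>.oper_singleton_nonmaximal[OF R fin True y]
            \<psi>.oper_singleton_nonmaximal[OF R fin True y] prof by blast
      qed
    next
      case False
      then show ?thesis using \<phi>.oper_singleton_le[OF R] \<psi>.oper_singleton_le[OF R] by blast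
    qed
    have "x \<in> oper \<phi> R A \<longleftrightarrow> x \<in> oper \<psi> R A" for x
      unfolding \<phi>.oper_iff_singletons[OF R fin, of x A] \<psi>.oper_iff_singletons[OF R fin, of x A]
      by (simp only: single)
    then show ?thesis by blast
  qed
  then show ?thesis
    unfolding equivalent_def S4_Iff_iff_ext ext_eq_oper[OF \<phi>.Fm] ext_eq_oper[OF \<psi>.Fm] by simp
qed

lemma six_formulas_Fm: "\<psi> \<in> six_formulas p \<Longrightarrow> \<psi> \<in> Fm p"
  by (auto simp: six_formulas_def Fm_def)

text \<open>For a singleton \<open>{a}\<close>, \<open>\<diamond> \<box> \<diamond> Var p\<close>
  asks for a point above \<open>x\<close> from which \<open>a\<close> is never lost from sight,
  which forces \<open>a\<close> to be maximal. Hence its last two bits vanish, and the disjunct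
  \<open>Var p\<close> restores only the last.\<close>

lemma profile_six_formulas:
  "profile \<bottom>\<^sub>m = (False, False, False, False, False)"
  "profile (Var p) = (False, False, True, False, True)"
  "profile (\<diamond> Var p) = (False, True, True, True, True)"
  "profile \<top>\<^sub>m = (True, True, True, True, True)"
  "profile (\<diamond> \<box> \<diamond> Var p) = (False, True, True, False, False)"
  "profile (\<diamond> \<box> \<diamond> Var p \<or>\<^sub>m Var p) = (False, True, True, False, True)"
  by (auto simp: profile_def oper_def capped_def split_option_ex split_option_all ex_bool_eq
      all_bool_eq)

lemma profile_additive:
  assumes "additive_formula p q \<phi>"
  shows "profile \<phi> \<in> profile ` six_formulas p"
proof (cases "() \<in> oper \<phi> point {}")
  case True
  interpret additive_formula p q \<phi> by fact
  have "profile \<phi> = (True, True, True, True, True)"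
    using True by (simp add: profile_def oper_UNIV[OF preorder_cluster True]
        oper_UNIV[OF preorder_capped True])
  then show ?thesis by (simp add: six_formulas_def profile_six_formulas)
next
  case False
  interpret additive_formula p q \<phi> by fact
  interpret normal_additive_formula p q \<phi> by unfold_locales fact
  show ?thesis using capped_imp_cluster capped_or_cluster_iff False
    by (simp add: six_formulas_def profile_six_formulas) (auto simp: profile_def)
qed

section \<open>Additivity of the six formulas\<close>

lemma oper_regular_closure_iff:
  "x \<in> oper (\<diamond> \<box> \<diamond> Var p) R A \<longleftrightarrow>
    (\<exists>y. R x y \<and> (\<forall>z. R y z \<longrightarrow> (\<exists>u. R z u \<and> u \<in> A)))"
  by (simp add: oper_def)

lemma oper_regular_closure_mono:
  assumes "A \<subseteq> B"
  shows "oper (\<diamond> \<box> \<diamond> Var p) R A \<subseteq> oper (\<diamond> \<box> \<diamond> Var p) R B"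
proof
  fix x assume "x \<in> oper (\<diamond> \<box> \<diamond> Var p) R A"
  then obtain y where "R x y" "\<And>z. R y z \<Longrightarrow> \<exists>u. R z u \<and> u \<in> A"
    unfolding oper_regular_closure_iff by blast
  moreover from this(2) have "\<exists>u. R z u \<and> u \<in> B" if "R y z" for z
    using that assms by blast
  ultimately show "x \<in> oper (\<diamond> \<box> \<diamond> Var p) R B"
    unfolding oper_regular_closure_iff by blast
qed

text \<open>On a preorder with upsets as open sets this is closure of interior of closure. Either
  all points above \<open>y\<close> see \<open>A\<close>, or some \<open>z\<close> above
  \<open>y\<close> sees none of it. In the latter case everything above \<open>z\<close> must see
  \<open>B\<close>, and \<open>z\<close> replaces \<open>y\<close> as witness.\<close>

lemma oper_regular_closure_Un:
  assumes "transp R"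
  shows "oper (\<diamond> \<box> \<diamond> Var p) R (A \<union> B) = oper (\<diamond> \<box> \<diamond> Var p) R A \<union> oper (\<diamond> \<box> \<diamond> Var p) R B"
    (is "?L = ?R")
proof
  show "?R \<subseteq> ?L" by (intro Un_least oper_regular_closure_mono Un_upper1 Un_upper2)
  show "?L \<subseteq> ?R"
  proof
    fix x assume "x \<in> ?L"
    then obtain y where y: "R x y" "\<forall>z. R y z \<longrightarrow> (\<exists>u. R z u \<and> u \<in> A \<union> B)"
      unfolding oper_regular_closure_iff by blast
    show "x \<in> ?R"
    proof (cases "\<forall>z. R y z \<longrightarrow> (\<exists>u. R z u \<and> u \<in> A)")
      case True
      then show ?thesis using y(1) unfolding Un_iff oper_regular_closure_iff by blast
    next
      case False
      then obtain z where z: "R y z" "\<forall>u. R z u \<longrightarrow> u \<notin> A" by blast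
      have "\<exists>u. R v u \<and> u \<in> B" if "R z v" for v
      proof -
        have "R y v" using transpD[OF assms z(1) that] .
        then obtain u where u: "R v u" "u \<in> A \<union> B" using y(2) by blast
        have "R z u" using transpD[OF assms that u(1)] .
        then show ?thesis using z(2) u by blast
      qed
      moreover have "R x z" using transpD[OF assms y(1) z(1)] .
      ultimately show ?thesis unfolding Un_iff oper_regular_closure_iff by blast
    qed
  qed
qed

lemma oper_six_formulas_Un:
  assumes "transp R" "\<psi> \<in> six_formulas p"
  shows "oper \<psi> R (A \<union> B) = oper \<psi> R A \<union> oper \<psi> R B"
proof -
  have or: "oper (\<diamond> \<box> \<diamond> Var p \<or>\<^sub>m Var p) R C = oper (\<diamond> \<box> \<diamond> Var p) R C \<union> C" for C
    by (simp add: oper_def)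
  have "oper (\<diamond> \<box> \<diamond> Var p \<or>\<^sub>m Var p) R (A \<union> B) =
      oper (\<diamond> \<box> \<diamond> Var p \<or>\<^sub>m Var p) R A \<union> oper (\<diamond> \<box> \<diamond> Var p \<or>\<^sub>m Var p) R B"
    unfolding or oper_regular_closure_Un[OF assms(1)] by (simp only: Un_ac)
  moreover have "oper (\<diamond> Var p) R (A \<union> B) = oper (\<diamond> Var p) R A \<union> oper (\<diamond> Var p) R B"
    unfolding oper_def ext.simps by blast
  moreover have "oper \<chi> R (A \<union> B) = oper \<chi> R A \<union> oper \<chi> R B"
    if "\<chi> \<in> {\<bottom>\<^sub>m, \<top>\<^sub>m, Var p}" for \<chi>
    using that by (auto simp: oper_def)
  ultimately show ?thesis
    using assms(2) oper_regular_closure_Un[OF assms(1), of p A B] unfolding six_formulas_def by blast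
qed

lemma six_formulas_additive:
  assumes "p \<noteq> q" "\<psi> \<in> six_formulas p"
  shows "additive_formula p q \<psi>"
proof
  show "p \<noteq> q" "\<psi> \<in> Fm p" using assms six_formulas_Fm by auto
  then show "additive_in S4 p q \<psi>"
    unfolding additive_in_def S4_Iff_iff_ext
    by (simp add: ext_inst oper_six_formulas_Un[OF _ assms(2)])
qed

text \<open>Together with the pairwise different profiles, this separates the six formulas.\<close>

lemma profile_eq_if_equivalent:
  assumes "equivalent S4 \<phi> \<psi>"
  shows "profile \<phi> = profile \<psi>"
  unfolding profile_def oper_def
    S4_Iff_sound[OF assms[unfolded equivalent_def] preorder_point]
    S4_Iff_sound[OF assms[unfolded equivalent_def] preorder_cluster]
    S4_Iff_sound[OF assms[unfolded equivalent_def] preorder_capped] ..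

lemma inj_on_profile_six_formulas: "inj_on profile (six_formulas p)"
  by (simp add: inj_on_def six_formulas_def profile_six_formulas)

text \<open>The value at the empty set is constant across reflexive frames, so one point decides
  it.\<close>

lemma normal_in_S4_iff:
  assumes "\<phi> \<in> Fm p"
  shows "normal_in S4 p \<phi> \<longleftrightarrow> () \<notin> oper \<phi> point {}"
proof
  assume "normal_in S4 p \<phi>"
  from S4_Iff_sound[OF this[unfolded normal_in_def] preorder_point]
  show "() \<notin> oper \<phi> point {}" by (simp add: ext_inst[OF assms])
next
  assume "() \<notin> oper \<phi> point {}"
  then show "normal_in S4 p \<phi>"
    unfolding normal_in_def S4_Iff_iff_ext
    by (simp add: ext_inst[OF assms] oper_empty_point[of _ \<phi>])
qed

theorem theorem6p8:
  fixes p q :: nat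
  assumes "p \<noteq> q"
  shows
    "card (six_formulas p) = 6 \<and>
     (\<forall>\<psi>\<in>six_formulas p. \<psi> \<in> Fm p \<and> additive_in S4 p q \<psi>) \<and>
     (\<forall>\<psi>\<in>six_formulas p. \<forall>\<psi>'\<in>six_formulas p. \<psi> \<noteq> \<psi>' \<longrightarrow> \<not> equivalent S4 \<psi> \<psi>') \<and>
     (\<forall>\<phi>\<in>Fm p. additive_in S4 p q \<phi> \<longrightarrow> (\<exists>\<psi>\<in>six_formulas p. equivalent S4 \<phi> \<psi>)) \<and>
     {\<psi> \<in> six_formulas p. normal_in S4 p \<psi>} = six_formulas p - {\<top>\<^sub>m} \<and>
     card {\<psi> \<in> six_formulas p. normal_in S4 p \<psi>} = 5"
proof -
  have card: "card (six_formulas p) = 6"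
    by (simp add: six_formulas_def)
  have additive: "additive_formula p q \<psi>" if "\<psi> \<in> six_formulas p" for \<psi>
    using six_formulas_additive assms that .
  have distinct: "\<not> equivalent S4 \<psi> \<psi>'"
    if "\<psi> \<in> six_formulas p" "\<psi>' \<in> six_formulas p" "\<psi> \<noteq> \<psi>'" for \<psi> \<psi>'
    using profile_eq_if_equivalent inj_onD[OF inj_on_profile_six_formulas] that by blast
  have complete: "\<exists>\<psi>\<in>six_formulas p. equivalent S4 \<phi> \<psi>"
    if "\<phi> \<in> Fm p" "additive_in S4 p q \<phi>" for \<phi>
  proof -
    have \<phi>: "additive_formula p q \<phi>" using assms that by unfold_locales
    then obtain \<psi> where "\<psi> \<in> six_formulas p" "profile \<phi> = profile \<psi>"
      using profile_additive by blast
    then show ?thesis using equivalent_if_profile_eq[OF \<phi> additive] by blast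
  qed
  have "() \<notin> oper \<psi> point {} \<longleftrightarrow> \<psi> \<noteq> \<top>\<^sub>m" if "\<psi> \<in> six_formulas p" for \<psi>
    using that by (auto simp: six_formulas_def oper_def)
  then have normal: "{\<psi> \<in> six_formulas p. normal_in S4 p \<psi>} = six_formulas p - {\<top>\<^sub>m}"
    using normal_in_S4_iff six_formulas_Fm by blast
  have "card (six_formulas p - {\<top>\<^sub>m}) = 5"
    using card by (subst card_Diff_singleton) (auto simp: six_formulas_def)
  then show ?thesis
    using card six_formulas_Fm additive additive_formula.additive distinct complete normal by auto
qed

end
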